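(* Let $B$ be a positive integer and $\tilde p$ a fixed integer. There is $\tilde q_{\min}$ such that for all real $\tilde q>\tilde q_{\min}$ the equation $\tilde Q(t)=0$ has five roots of multiplicity one satisfying the condition ($t>0$ if $t$ is real, $\operatorname{Im}t>0$ if $t$ is non-real). Three of them, $t_1,t_2,t_3$, are real, with asymptotics as $\tilde q\to+\infty$ $$t_1\sim B^{2}\tilde q^{6},\qquad t_2\sim B^{2}\tilde q^{6},\qquad t_3\sim B\,\tilde q^{4}.$$ The other two, $t_4,t_5$, are complex, with asymptotics as $\tilde q\to+\infty$ $$t_4\sim(\sqrt2+1)\,i\,\tilde q^{2},\qquad t_5\sim(\sqrt2-1)\,i\,\tilde q^{2}.$$
   Context: For numbers $p,q$ let $$Q_{pq}(t)=t^{10}+(2q^{2}+p^{2})(3q^{2}-2p^{2})\,t^{8}+(q^{8}+10p^{2}q^{6}+4p^{4}q^{4}-14p^{6}q^{2}+p^{8})\,t^{6}-p^{2}q^{2}(q^{8}-14p^{2}q^{6}+4p^{4}q^{4}+10p^{6}q^{2}+p^{8})\,t^{4}-p^{6}q^{6}(q^{2}+2p^{2})(3p^{2}-2q^{2})\,t^{2}-q^{10}p^{10}.$$ Given $B$, $\tilde p$, $\tilde q$, define $\tilde Q(t)=Q_{pq}(t)$ with $p=B\tilde q^{3}-\tilde p$ and $q=\tilde q$. Here $i=\sqrt{-1}$, and $f\sim g$ means $f/g\to1$. *)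

theory Defs
  imports
    Complex_Main
    "HOL-Library.Landau_Symbols"
    "HOL-Computational_Algebra.Polynomial"
begin

definition Q_poly :: "'a::comm_ring_1 \<Rightarrow> 'a \<Rightarrow> 'a poly" where
  "Q_poly p q =
     monom 1 10
   + monom ((2 * q^2 + p^2) * (3 * q^2 - 2 * p^2)) 8
   + monom (q^8 + 10 * p^2 * q^6 + 4 * p^4 * q^4 - 14 * p^6 * q^2 + p^8) 6
   - monom (p^2 * q^2 * (q^8 - 14 * p^2 * q^6 + 4 * p^4 * q^4 + 10 * p^6 * q^2 + p^8)) 4
   - monom (p^6 * q^6 * (q^2 + 2 * p^2) * (3 * p^2 - 2 * q^2)) 2
   - monom (q^10 * p^10) 0"

definition Q_tilde :: "'a::comm_ring_1 \<Rightarrow> 'a \<Rightarrow> 'a \<Rightarrow> 'a poly" where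
  "Q_tilde B p' q' = Q_poly (B * q'^3 - p') q'"

definition root_condition :: "complex \<Rightarrow> bool" where
  "root_condition t \<longleftrightarrow> (if t \<in> \<real> then Re t > 0 else Im t > 0)"

end

theory Submission
  imports Defs "HOL-Real_Asymp.Real_Asymp"
begin

text \<open>
  \<open>Q\<^sub>p\<^sub>q\<close> is a polynomial of degree five in \<open>t\<^sup>2\<close>, and it is homogeneous if \<open>t\<close> is given weight 2,
  so with \<open>w = q / p\<close> it suffices to study \<open>p = 1\<close>, \<open>q = w\<close> as \<open>w\<close> tends to 0 from the right.
  Reading off the dominant terms, the reduced quintic in \<open>s = t\<^sup>2\<close> behaves like \<open>s\<^sup>3 (s - 1)\<^sup>2\<close> with
  the negative value \<open>-16 w\<^sup>2\<close> at \<open>s = 1\<close> to leading order (two roots near 1), like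
  \<open>s\<^sup>2 (s - w\<^sup>2)\<close> at scale \<open>w\<^sup>2\<close>, and like \<open>- (\<sigma>\<^sup>2 + 6 \<sigma> + 1)\<close> at scale \<open>s = w\<^sup>4 \<sigma>\<close>, whose zeros are
  \<open>\<sigma> = - (\<surd>2 \<plusminus> 1)\<^sup>2\<close>. A sign change across an interval of scaled half-width \<open>\<surd>w\<close> locates each of the
  five roots. Their square roots, up to sign, are ten distinct zeros of a polynomial of degree ten,
  hence all zeros, and all are simple.
\<close>

section \<open>Reduction to a quintic by weighted homogeneity\<close>

text \<open>The value of \<^term>\<open>Q_poly 1 w\<close> at \<open>t\<close>, as a function of \<open>s = t\<^sup>2\<close>.\<close>
definition Q_red :: "'a::comm_ring_1 \<Rightarrow> 'a \<Rightarrow> 'a" where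
  "Q_red w s = s^5 + (2 * w^2 + 1) * (3 * w^2 - 2) * s^4
     + (w^8 + 10 * w^6 + 4 * w^4 - 14 * w^2 + 1) * s^3
     - w^2 * (w^8 - 14 * w^6 + 4 * w^4 + 10 * w^2 + 1) * s^2
     - w^6 * (w^2 + 2) * (3 - 2 * w^2) * s - w^10"

text \<open>With weight 1 for \<open>p\<close> and \<open>q\<close> and weight 2 for
  \<open>t\<close>, every monomial of \<open>Q_poly\<close> has weight 20, whence the factor
  \<open>p^20\<close>.\<close>

lemma poly_Q_poly_scaled:
  "poly (Q_poly p (w * p)) (p^2 * t) = p^20 * Q_red w (t^2)"
  unfolding Q_poly_def Q_red_def by (simp add: poly_monom algebra_simps eval_nat_numeral)

lemma Q_red_of_real: "Q_red (of_real w) (of_real s) = (of_real (Q_red w s) :: complex)"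
  by (simp add: Q_red_def)

lemma degree_Q_poly: "degree (Q_poly p q :: 'a::comm_ring_1 poly) = 10"
proof (rule antisym)
  show "degree (Q_poly p q) \<le> 10"
    unfolding Q_poly_def by (intro degree_add_le degree_diff_le order.trans[OF degree_monom_le]) auto
  show "10 \<le> degree (Q_poly p q)"
    by (rule le_degree) (simp add: Q_poly_def)
qed

section \<open>Simplicity of roots by counting\<close>

text \<open>A root \<open>x\<close> of multiplicity at least 2 would leave a cofactor of degree
  \<open>degree P - 2\<close> that still vanishes at the other \<open>degree P - 1\<close> elements
  of \<open>S\<close>, one too many.\<close>

lemma roots_simple_if_card_eq_degree:
  fixes P :: "'a::idom poly"
  assumes "P \<noteq> 0" and S: "\<And>x. x \<in> S \<Longrightarrow> poly P x = 0" and card: "card S = degree P"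
  shows "{x. poly P x = 0} = S" and "\<And>x. x \<in> S \<Longrightarrow> order x P = 1"
proof -
  have fin: "finite {x. poly P x = 0}"
    by (rule poly_roots_finite[OF assms(1)])
  show eq: "{x. poly P x = 0} = S"
    using card_seteq[OF fin, of S] S card card_poly_roots_bound[OF assms(1)] by auto
  fix x assume x: "x \<in> S"
  have "order x P \<noteq> 0"
    using S[OF x] assms(1) order_root by blast
  moreover have "\<not> 2 \<le> order x P"
  proof
    assume "2 \<le> order x P"
    then obtain R where R: "P = [:-x, 1:]^2 * R"
      using order_divides dvdE by metis
    with assms(1) have "R \<noteq> 0" by auto
    then have deg: "degree P = 2 + degree R"
      unfolding R by (subst degree_mult_eq) (auto simp: degree_power_eq)
    have "S - {x} \<subseteq> {y. poly R y = 0}"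
      using S unfolding R by auto
    then have "card (S - {x}) \<le> degree R"
      using card_mono[OF poly_roots_finite] card_poly_roots_bound \<open>R \<noteq> 0\<close> order.trans by blast
    with deg card x fin eq show False
      by simp
  qed
  ultimately show "order x P = 1" by linarith
qed

section \<open>Zeros of the reduced quintic as \<open>w\<close> tends to 0\<close>

text \<open>Intermediate value theorem for each \<open>w\<close> separately, then choice; no
  continuity of \<open>\<sigma>\<close> in \<open>w\<close> is claimed. The product form of the sign
  condition covers both directions of crossing, and the limit follows by squeezing.\<close>

lemma root_in_shrinking_interval:
  fixes G :: "real \<Rightarrow> real \<Rightarrow> real" and l u :: "real \<Rightarrow> real"
  assumes cont: "\<And>w. continuous_on UNIV (G w)"
    and lu: "\<forall>\<^sub>F w in F. l w < u w" and sign: "\<forall>\<^sub>F w in F. G w (l w) * G w (u w) < 0"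
    and lim: "(l \<longlongrightarrow> c) F" "(u \<longlongrightarrow> c) F"
  obtains \<sigma> where "\<forall>\<^sub>F w in F. l w < \<sigma> w \<and> \<sigma> w < u w \<and> G w (\<sigma> w) = 0" "(\<sigma> \<longlongrightarrow> c) F"
proof -
  have "\<forall>\<^sub>F w in F. \<exists>s. l w < s \<and> s < u w \<and> G w s = 0"
    using lu sign
  proof eventually_elim
    case (elim w)
    have c: "continuous_on {l w..u w} (G w)"
      by (rule continuous_on_subset[OF cont]) auto
    have "\<exists>s\<ge>l w. s \<le> u w \<and> G w s = 0"
      using elim IVT'[of "G w" "l w" 0 "u w"] IVT2'[of "G w" "u w" 0 "l w"] c
      by (auto simp: mult_less_0_iff)
    then obtain s where s: "l w \<le> s" "s \<le> u w" "G w s = 0" by blast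
    \<comment> \<open>A zero at an endpoint would make the product of the two end values
      vanish.\<close>
    with elim have "s \<noteq> l w" "s \<noteq> u w" by auto
    with s show ?case by (intro exI[of _ s]) auto
  qed
  then obtain \<sigma> where \<sigma>: "\<forall>\<^sub>F w in F. l w < \<sigma> w \<and> \<sigma> w < u w \<and> G w (\<sigma> w) = 0"
    unfolding eventually_ex by blast
  moreover have "(\<sigma> \<longlongrightarrow> c) F"
    by (rule tendsto_sandwich[OF _ _ lim]) (use \<sigma> in \<open>auto elim: eventually_mono\<close>)
  ultimately show ?thesis by (rule that)
qed

lemma continuous_Q_red: "continuous_on UNIV (\<lambda>\<sigma>. Q_red w (k * \<sigma>) :: real)"
  unfolding Q_red_def by (intro continuous_intros)

text \<open>\<open>Q_red w (w^4 * \<sigma>)\<close> is \<open>w^10\<close> times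
  \<open>- (\<sigma>^2 + 6 * \<sigma> + 1)\<close> plus an error of order \<open>w^2\<close>. The
  derivative \<open>2*c + 6\<close> of the quadratic at its zero \<open>c\<close> is nonzero, so an
  offset of \<open>sqrt w\<close> changes it by order \<open>sqrt w\<close>, which beats the
  error.\<close>

lemma Q_red_sign_change_at_fourth_power_scale:
  fixes c :: real
  assumes c: "c^2 + 6 * c + 1 = 0" and "c \<noteq> -3"
  shows "\<forall>\<^sub>F w in at_right 0. Q_red w (w^4 * (c - sqrt w)) * Q_red w (w^4 * (c + sqrt w)) < 0"
proof -
  \<comment> \<open>\<open>w^12 * K d w\<close> collects the terms beyond order \<open>w^10\<close>
    at \<open>\<sigma> = c + d\<close>; as \<open>c\<close> is a zero, the quadratic there equals
    \<open>d * (2*c + 6 + d)\<close>.\<close>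
  define K where "K d w = (c + d)^5 * w^8 + (2 * w^2 + 1) * (3 * w^2 - 2) * w^4 * (c + d)^4
     + (w^8 + 10 * w^6 + 4 * w^4 - 14 * w^2 + 1) * (c + d)^3
     - (w^6 - 14 * w^4 + 4 * w^2 + 10) * (c + d)^2 - (- 1 - 2 * w^2) * (c + d)" for d w :: real
  \<comment> \<open>What remains at \<open>d = \<delta> * sqrt w\<close> once
    \<open>w^10 * sqrt w\<close> is factored out; it has a nonzero limit of sign opposite for
    \<open>\<delta> = 1\<close> and \<open>\<delta> = -1\<close>.\<close>
  define A where "A \<delta> w = - \<delta> * (2*c + 6 + \<delta> * sqrt w) + w * sqrt w * K (\<delta> * sqrt w) w" for \<delta> w :: real
  have K: "Q_red w (w^4 * (c + d)) = w^10 * (- d * (2*c + 6 + d) + w^2 * K d w)" for w d :: real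
    using c unfolding Q_red_def K_def by algebra
  have A: "Q_red w (w^4 * (c + \<delta> * sqrt w)) = w^10 * sqrt w * A \<delta> w" if "w > 0" for w \<delta> :: real
  proof -
    \<comment> \<open>Abstracting \<open>sqrt w\<close> to \<open>h\<close> with
      \<open>h * h = w\<close> leaves a polynomial identity.\<close>
    have "w^10 * (- (\<delta> * h) * (e + \<delta> * h) + w^2 * k) = w^10 * h * (- \<delta> * (e + \<delta> * h) + w * h * k)"
      if "h * h = w" for h e k
      unfolding that[symmetric] by algebra
    then show ?thesis
      unfolding K A_def using \<open>w > 0\<close> by simp
  qed
  have sqrt0: "(sqrt \<longlongrightarrow> 0) (at_right 0)" and id0: "((\<lambda>w. w) \<longlongrightarrow> 0) (at_right (0::real))"
    by real_asymp+
  have "(A \<delta> \<longlongrightarrow> - \<delta> * (2*c + 6)) (at_right 0)" for \<delta>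
    unfolding A_def K_def by (rule tendsto_eq_intros sqrt0 id0 refl)+ simp
  from tendsto_mult[OF this[of "-1"] this[of 1]]
  have "((\<lambda>w. A (-1) w * A 1 w) \<longlongrightarrow> - ((2*c + 6)^2)) (at_right 0)"
    by (simp add: power2_eq_square algebra_simps)
  moreover have "- ((2*c + 6)^2) < 0"
    using \<open>c \<noteq> -3\<close> by (simp add: add_eq_0_iff)
  ultimately have "\<forall>\<^sub>F w in at_right 0. A (-1) w * A 1 w < 0"
    by (rule order_tendstoD(2))
  moreover have "\<forall>\<^sub>F w in at_right (0::real). w > 0"
    by (simp add: eventually_at_right_less)
  ultimately show ?thesis
  proof eventually_elim
    case (elim w)
    have "Q_red w (w^4 * (c - sqrt w)) * Q_red w (w^4 * (c + sqrt w))
        = (w^10 * sqrt w)^2 * (A (-1) w * A 1 w)"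
      using A[of w "-1"] A[of w 1] elim by (simp add: power2_eq_square)
    moreover have "(w^10 * sqrt w)^2 > 0"
      using elim by simp
    ultimately show ?case
      using elim by (simp add: mult_less_0_iff)
  qed
qed

lemma roots_Q_red_asymptotics:
  obtains \<sigma>1 \<sigma>2 \<sigma>3 \<sigma>4 \<sigma>5 :: "real \<Rightarrow> real"
  where "(\<sigma>1 \<longlongrightarrow> 1) (at_right 0)" "(\<sigma>2 \<longlongrightarrow> 1) (at_right 0)" "(\<sigma>3 \<longlongrightarrow> 1) (at_right 0)"
    "(\<sigma>4 \<longlongrightarrow> - ((sqrt 2 + 1)^2)) (at_right 0)" "(\<sigma>5 \<longlongrightarrow> - ((sqrt 2 - 1)^2)) (at_right 0)"
    "\<forall>\<^sub>F w in at_right 0. \<sigma>2 w < \<sigma>1 w \<and> Q_red w (\<sigma>1 w) = 0 \<and> Q_red w (\<sigma>2 w) = 0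
       \<and> Q_red w (w^2 * \<sigma>3 w) = 0 \<and> Q_red w (w^4 * \<sigma>4 w) = 0 \<and> Q_red w (w^4 * \<sigma>5 w) = 0"
proof -
  have sqrt_pos: "\<forall>\<^sub>F w in at_right 0. 0 < sqrt w"
    by real_asymp
  have lims: "((\<lambda>w. c - sqrt w) \<longlongrightarrow> c) (at_right 0)" "((\<lambda>w. c + sqrt w) \<longlongrightarrow> c) (at_right 0)" for c
    by real_asymp+
  \<comment> \<open>At \<open>s = 1\<close> the value is about \<open>-16 * w^2\<close>, while at
    \<open>1 + sqrt w\<close> and \<open>1 - sqrt w\<close> the term \<open>s^3 * (s - 1)^2\<close>
    is about \<open>w\<close> and dominates. One-sided intervals sharing the endpoint 1 keep the two
    roots apart. The factor \<open>1 *\<close> only matches the shape of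
    \<open>continuous_Q_red\<close>.\<close>
  have "\<forall>\<^sub>F w in at_right 0. Q_red w (1 * 1) * Q_red w (1 * (1 + sqrt w)) < 0"
    unfolding Q_red_def by real_asymp
  then obtain \<sigma>1 where 1: "\<forall>\<^sub>F w in at_right 0. 1 < \<sigma>1 w \<and> \<sigma>1 w < 1 + sqrt w \<and> Q_red w (1 * \<sigma>1 w) = 0"
      "(\<sigma>1 \<longlongrightarrow> 1) (at_right 0)"
    by (rule root_in_shrinking_interval[OF continuous_Q_red, rotated])
      (use sqrt_pos lims in \<open>auto intro: tendsto_const\<close>)
  have "\<forall>\<^sub>F w in at_right 0. Q_red w (1 * (1 - sqrt w)) * Q_red w (1 * 1) < 0"
    unfolding Q_red_def by real_asymp
  then obtain \<sigma>2 where 2: "\<forall>\<^sub>F w in at_right 0. 1 - sqrt w < \<sigma>2 w \<and> \<sigma>2 w < 1 \<and> Q_red w (1 * \<sigma>2 w) = 0"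
      "(\<sigma>2 \<longlongrightarrow> 1) (at_right 0)"
    by (rule root_in_shrinking_interval[OF continuous_Q_red, rotated])
      (use sqrt_pos lims in \<open>auto intro: tendsto_const\<close>)
  \<comment> \<open>At \<open>s = w^2 * \<sigma>\<close> the leading term is
    \<open>w^6 * \<sigma>^2 * (\<sigma> - 1)\<close>, with its sign change at 1.\<close>
  have "\<forall>\<^sub>F w in at_right 0. Q_red w (w^2 * (1 - sqrt w)) * Q_red w (w^2 * (1 + sqrt w)) < 0"
    unfolding Q_red_def by real_asymp
  then obtain \<sigma>3 where 3: "\<forall>\<^sub>F w in at_right 0. 1 - sqrt w < \<sigma>3 w \<and> \<sigma>3 w < 1 + sqrt w \<and> Q_red w (w^2 * \<sigma>3 w) = 0"
      "(\<sigma>3 \<longlongrightarrow> 1) (at_right 0)"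
    by (rule root_in_shrinking_interval[OF continuous_Q_red, rotated])
      (use sqrt_pos lims in \<open>auto intro: tendsto_const\<close>)
  have quad: "\<exists>\<sigma>. (\<forall>\<^sub>F w in at_right 0. Q_red w (w^4 * \<sigma> w) = 0) \<and> (\<sigma> \<longlongrightarrow> c) (at_right 0)"
    if c: "c^2 + 6 * c + 1 = 0" "c \<noteq> -3" for c :: real
  proof -
    obtain \<sigma> where "\<forall>\<^sub>F w in at_right 0. c - sqrt w < \<sigma> w \<and> \<sigma> w < c + sqrt w \<and> Q_red w (w^4 * \<sigma> w) = 0"
      "(\<sigma> \<longlongrightarrow> c) (at_right 0)"
      by (rule root_in_shrinking_interval[OF continuous_Q_red _
            Q_red_sign_change_at_fourth_power_scale[OF c] lims])
        (use sqrt_pos in simp_all)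
    then show ?thesis by (auto elim: eventually_mono)
  qed
  \<comment> \<open>The zeros of the quadratic are \<open>-3 - 2 * r\<close> with
    \<open>r^2 = 2\<close>; leaving the sign of \<open>r\<close> open treats both at once.\<close>
  have quadratic: "(- ((r + 1)^2))^2 + 6 * (- ((r + 1)^2)) + 1 = 0" "- ((r + 1)^2) \<noteq> -3"
    if "r^2 = 2" for r :: real
  proof -
    have sq: "(r + 1)^2 = 3 + 2 * r"
      using that by (simp add: power2_sum)
    show "(- ((r + 1)^2))^2 + 6 * (- ((r + 1)^2)) + 1 = 0"
      unfolding sq using that by (simp add: power2_eq_square algebra_simps)
    show "- ((r + 1)^2) \<noteq> -3"
      unfolding sq using that by auto
  qed
  obtain \<sigma>4 where 4: "\<forall>\<^sub>F w in at_right 0. Q_red w (w^4 * \<sigma>4 w) = 0"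
      "(\<sigma>4 \<longlongrightarrow> - ((sqrt 2 + 1)^2)) (at_right 0)"
    using quad[OF quadratic[of "sqrt 2"]] by auto
  obtain \<sigma>5 where 5: "\<forall>\<^sub>F w in at_right 0. Q_red w (w^4 * \<sigma>5 w) = 0"
      "(\<sigma>5 \<longlongrightarrow> - ((sqrt 2 - 1)^2)) (at_right 0)"
    using quad[OF quadratic[of "- sqrt 2"]] by (auto simp: power2_commute[of 1])
  have "\<forall>\<^sub>F w in at_right 0. \<sigma>2 w < \<sigma>1 w \<and> Q_red w (\<sigma>1 w) = 0 \<and> Q_red w (\<sigma>2 w) = 0
       \<and> Q_red w (w^2 * \<sigma>3 w) = 0 \<and> Q_red w (w^4 * \<sigma>4 w) = 0 \<and> Q_red w (w^4 * \<sigma>5 w) = 0"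
    using 1(1) 2(1) 3(1) 4(1) 5(1) by eventually_elim auto
  from that[OF 1(2) 2(2) 3(2) 4(2) 5(2) this] show ?thesis .
qed

text \<open>Under square roots the scales \<open>w^2\<close> and \<open>w^4\<close> become the
  factors \<open>w\<close> and \<open>w^2\<close>, and negative zeros become minus a square. The
  strict inequalities later make the five roots distinct.\<close>

lemma roots_Q_red_square_asymptotics:
  obtains \<tau>1 \<tau>2 \<tau>3 \<tau>4 \<tau>5 :: "real \<Rightarrow> real"
  where "(\<tau>1 \<longlongrightarrow> 1) (at_right 0)" "(\<tau>2 \<longlongrightarrow> 1) (at_right 0)" "(\<tau>3 \<longlongrightarrow> 1) (at_right 0)"
    "(\<tau>4 \<longlongrightarrow> sqrt 2 + 1) (at_right 0)" "(\<tau>5 \<longlongrightarrow> sqrt 2 - 1) (at_right 0)"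
    "\<forall>\<^sub>F w in at_right 0. w > 0 \<and> 0 < w * \<tau>3 w \<and> w * \<tau>3 w < \<tau>2 w \<and> \<tau>2 w < \<tau>1 w \<and>
       0 < \<tau>5 w \<and> \<tau>5 w < \<tau>4 w \<and>
       Q_red w (\<tau>1 w ^ 2) = 0 \<and> Q_red w (\<tau>2 w ^ 2) = 0 \<and> Q_red w ((w * \<tau>3 w)^2) = 0 \<and>
       Q_red w (- ((w^2 * \<tau>4 w)^2)) = 0 \<and> Q_red w (- ((w^2 * \<tau>5 w)^2)) = 0"
proof -
  from roots_Q_red_asymptotics obtain \<sigma>1 \<sigma>2 \<sigma>3 \<sigma>4 \<sigma>5 :: "real \<Rightarrow> real" where
    lim: "(\<sigma>1 \<longlongrightarrow> 1) (at_right 0)" "(\<sigma>2 \<longlongrightarrow> 1) (at_right 0)" "(\<sigma>3 \<longlongrightarrow> 1) (at_right 0)"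
    "(\<sigma>4 \<longlongrightarrow> - ((sqrt 2 + 1)^2)) (at_right 0)" "(\<sigma>5 \<longlongrightarrow> - ((sqrt 2 - 1)^2)) (at_right 0)" and
    ev: "\<forall>\<^sub>F w in at_right 0. \<sigma>2 w < \<sigma>1 w \<and> Q_red w (\<sigma>1 w) = 0 \<and> Q_red w (\<sigma>2 w) = 0
       \<and> Q_red w (w^2 * \<sigma>3 w) = 0 \<and> Q_red w (w^4 * \<sigma>4 w) = 0 \<and> Q_red w (w^4 * \<sigma>5 w) = 0" .
  define \<tau>1 \<tau>2 \<tau>3 \<tau>4 \<tau>5 where \<tau>: "\<tau>1 = (\<lambda>w. sqrt (\<sigma>1 w))" "\<tau>2 = (\<lambda>w. sqrt (\<sigma>2 w))" "\<tau>3 = (\<lambda>w. sqrt (\<sigma>3 w))"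
    "\<tau>4 = (\<lambda>w. sqrt (- \<sigma>4 w))" "\<tau>5 = (\<lambda>w. sqrt (- \<sigma>5 w))"
  have \<tau>lim: "(\<tau>1 \<longlongrightarrow> 1) (at_right 0)" "(\<tau>2 \<longlongrightarrow> 1) (at_right 0)" "(\<tau>3 \<longlongrightarrow> 1) (at_right 0)"
    "(\<tau>4 \<longlongrightarrow> sqrt 2 + 1) (at_right 0)" "(\<tau>5 \<longlongrightarrow> sqrt 2 - 1) (at_right 0)"
    unfolding \<tau> by (rule tendsto_eq_intros lim refl | simp)+
  have w0: "((\<lambda>w. w) \<longlongrightarrow> 0) (at_right (0::real))" by real_asymp
  \<comment> \<open>Different limits separate these pairs. \<open>\<tau>1\<close> and
    \<open>\<tau>2\<close> share the limit 1, so their order must come from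
    \<open>\<sigma>2 w < \<sigma>1 w\<close>.\<close>
  have "((\<lambda>w. \<tau>2 w - w * \<tau>3 w) \<longlongrightarrow> 1) (at_right 0)"
    by (rule tendsto_eq_intros w0 \<tau>lim refl)+ simp
  then have e1: "\<forall>\<^sub>F w in at_right 0. 0 < \<tau>2 w - w * \<tau>3 w"
    by (rule order_tendstoD) simp
  have "((\<lambda>w. \<tau>4 w - \<tau>5 w) \<longlongrightarrow> 2) (at_right 0)"
    by (rule tendsto_eq_intros \<tau>lim refl)+ simp
  then have e2: "\<forall>\<^sub>F w in at_right 0. 0 < \<tau>4 w - \<tau>5 w"
    by (rule order_tendstoD) simp
  have e3: "\<forall>\<^sub>F w in at_right 0. 0 < \<tau>3 w" "\<forall>\<^sub>F w in at_right 0. 0 < \<tau>5 w"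
    by (rule order_tendstoD[OF \<tau>lim(3)] order_tendstoD[OF \<tau>lim(5)]; simp)+
  have "\<forall>\<^sub>F w in at_right (0::real). 0 < w"
    by (simp add: eventually_at_right_less)
  from ev e1 e2 e3 this have "\<forall>\<^sub>F w in at_right 0. w > 0 \<and> 0 < w * \<tau>3 w \<and> w * \<tau>3 w < \<tau>2 w \<and> \<tau>2 w < \<tau>1 w \<and>
       0 < \<tau>5 w \<and> \<tau>5 w < \<tau>4 w \<and>
       Q_red w (\<tau>1 w ^ 2) = 0 \<and> Q_red w (\<tau>2 w ^ 2) = 0 \<and> Q_red w ((w * \<tau>3 w)^2) = 0 \<and>
       Q_red w (- ((w^2 * \<tau>4 w)^2)) = 0 \<and> Q_red w (- ((w^2 * \<tau>5 w)^2)) = 0"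
  proof eventually_elim
    case (elim w)
    have "0 < w * \<tau>3 w" using elim by simp
    with elim have "0 < \<tau>2 w" "0 < \<tau>4 w" by linarith+
    \<comment> \<open>\<open>sqrt\<close> is extended to negative reals as an odd function, so a
      positive value forces a positive argument.\<close>
    then have "0 < \<sigma>2 w" "0 < \<sigma>3 w" "\<sigma>4 w < 0" "\<sigma>5 w < 0"
      using elim by (simp_all add: \<tau>)
    with elim have sq: "\<tau>1 w ^ 2 = \<sigma>1 w" "\<tau>2 w ^ 2 = \<sigma>2 w" "(w * \<tau>3 w)^2 = w^2 * \<sigma>3 w"
      "- ((w^2 * \<tau>4 w)^2) = w^4 * \<sigma>4 w" "- ((w^2 * \<tau>5 w)^2) = w^4 * \<sigma>5 w"
      by (simp_all add: \<tau> power_mult_distrib)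
    have "\<tau>2 w < \<tau>1 w" using elim by (simp add: \<tau>)
    then show ?case
      unfolding sq using elim \<open>0 < w * \<tau>3 w\<close> by simp
  qed
  from that[OF \<tau>lim this] show ?thesis .
qed

section \<open>Return to the original polynomial and its asymptotics\<close>

text \<open>\<open>Q_poly\<close> is even in \<open>t\<close>, and \<open>root_condition\<close>
  never holds at both \<open>t\<close> and \<open>- t\<close>. So \<open>R\<close> and its negatives
  are ten distinct zeros, as many as the degree.\<close>

lemma Q_poly_roots_from_half:
  fixes p q :: complex
  assumes cond: "\<And>t. t \<in> R \<Longrightarrow> root_condition t" and root: "\<And>t. t \<in> R \<Longrightarrow> poly (Q_poly p q) t = 0"
    and card: "card R = 5"
  shows "{t. poly (Q_poly p q) t = 0 \<and> root_condition t} = R" and "\<forall>t\<in>R. order t (Q_poly p q) = 1"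
proof -
  have neg: "\<not> root_condition (- t)" if "root_condition t" for t
    using that by (auto simp: root_condition_def split: if_splits)
  have fin: "finite R" using card card.infinite by fastforce
  have disj: "R \<inter> uminus ` R = {}" using cond neg by force
  have "card (R \<union> uminus ` R) = degree (Q_poly p q)"
    using fin disj card by (simp add: card_Un_disjoint card_image degree_Q_poly)
  moreover have "poly (Q_poly p q) t = 0" if "t \<in> R \<union> uminus ` R" for t
    using that root by (auto simp: Q_poly_def poly_monom)
  moreover have "Q_poly p q \<noteq> 0" using degree_Q_poly[of p q] by force
  ultimately have *: "{t. poly (Q_poly p q) t = 0} = R \<union> uminus ` R"
      "\<And>t. t \<in> R \<union> uminus ` R \<Longrightarrow> order t (Q_poly p q) = 1"
    using roots_simple_if_card_eq_degree[of "Q_poly p q" "R \<union> uminus ` R"] by blast+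
  have "{t. poly (Q_poly p q) t = 0 \<and> root_condition t} = {t. poly (Q_poly p q) t = 0} \<inter> Collect root_condition"
    by auto
  also have "\<dots> = R" unfolding *(1) using cond neg by auto
  finally show "{t. poly (Q_poly p q) t = 0 \<and> root_condition t} = R" .
  show "\<forall>t\<in>R. order t (Q_poly p q) = 1" using *(2) by simp
qed

theorem theorem3p2:
  fixes B p' :: int
  assumes "B > 0"
  shows "\<exists>q_min :: real. \<exists>(t1 :: real \<Rightarrow> real) (t2 :: real \<Rightarrow> real) (t3 :: real \<Rightarrow> real)
           (t4 :: real \<Rightarrow> complex) (t5 :: real \<Rightarrow> complex).
    (\<forall>q' > q_min.
       (let Q = Q_tilde (of_int B) (of_int p') (complex_of_real q');
            R = {complex_of_real (t1 q'), complex_of_real (t2 q'), complex_of_real (t3 q'),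
                 t4 q', t5 q'}
        in {t. poly Q t = 0 \<and> root_condition t} = R \<and> card R = 5 \<and>
           (\<forall>t\<in>R. order t Q = 1) \<and> t4 q' \<notin> \<real> \<and> t5 q' \<notin> \<real>)) \<and>
    t1 \<sim>[at_top] (\<lambda>q'. (of_int B)\<^sup>2 * q' ^ 6) \<and>
    t2 \<sim>[at_top] (\<lambda>q'. (of_int B)\<^sup>2 * q' ^ 6) \<and>
    t3 \<sim>[at_top] (\<lambda>q'. of_int B * q' ^ 4) \<and>
    t4 \<sim>[at_top] (\<lambda>q'. of_real (sqrt 2 + 1) * \<i> * of_real q' ^ 2) \<and>
    t5 \<sim>[at_top] (\<lambda>q'. of_real (sqrt 2 - 1) * \<i> * of_real q' ^ 2)"
proof -
  from roots_Q_red_square_asymptotics obtain \<tau>1 \<tau>2 \<tau>3 \<tau>4 \<tau>5 :: "real \<Rightarrow> real" where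
    lim: "(\<tau>1 \<longlongrightarrow> 1) (at_right 0)" "(\<tau>2 \<longlongrightarrow> 1) (at_right 0)" "(\<tau>3 \<longlongrightarrow> 1) (at_right 0)"
    "(\<tau>4 \<longlongrightarrow> sqrt 2 + 1) (at_right 0)" "(\<tau>5 \<longlongrightarrow> sqrt 2 - 1) (at_right 0)" and
    ev: "\<forall>\<^sub>F w in at_right 0. w > 0 \<and> 0 < w * \<tau>3 w \<and> w * \<tau>3 w < \<tau>2 w \<and> \<tau>2 w < \<tau>1 w \<and>
       0 < \<tau>5 w \<and> \<tau>5 w < \<tau>4 w \<and>
       Q_red w (\<tau>1 w ^ 2) = 0 \<and> Q_red w (\<tau>2 w ^ 2) = 0 \<and> Q_red w ((w * \<tau>3 w)^2) = 0 \<and>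
       Q_red w (- ((w^2 * \<tau>4 w)^2)) = 0 \<and> Q_red w (- ((w^2 * \<tau>5 w)^2)) = 0" .
  define b c :: real where "b = of_int B" and "c = of_int p'"
  have b: "b > 0" using assms by (simp add: b_def)
  define p where "p x = b * x^3 - c" for x :: real
  define w where "w x = x / p x" for x :: real
  have p_pos: "\<forall>\<^sub>F x in at_top. p x > 0" and p_equiv: "((\<lambda>x. p x / (b * x^3)) \<longlongrightarrow> 1) at_top"
    unfolding p_def using b by real_asymp+
  \<comment> \<open>\<open>w x\<close> behaves like \<open>1 / (b * x^2)\<close>, so facts about
    small positive \<open>w\<close> become facts about large \<open>x\<close>.\<close>
  have w_lim: "filterlim w (at_right 0) at_top"
    unfolding w_def p_def using b by real_asymp
  have x_pos: "\<forall>\<^sub>F x in at_top. x > (0::real)" by (rule eventually_gt_at_top)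
  \<comment> \<open>By \<open>poly_Q_poly_scaled\<close> each root gains the factor
    \<open>p x ^ 2\<close>. Since \<open>p x * w x = x\<close> for large \<open>x\<close>, the sizes
    \<open>1\<close>, \<open>w\<close>, \<open>w^2\<close> become \<open>p x ^ 2\<close>,
    \<open>p x * x\<close> and \<open>x^2\<close>.\<close>
  define t1 t2 t3 where t123: "t1 x = p x ^ 2 * \<tau>1 (w x)" "t2 x = p x ^ 2 * \<tau>2 (w x)"
    "t3 x = p x ^ 2 * (w x * \<tau>3 (w x))" for x
  define t4 t5 where t45: "t4 x = \<i> * of_real (p x ^ 2 * (w x ^ 2 * \<tau>4 (w x)))"
    "t5 x = \<i> * of_real (p x ^ 2 * (w x ^ 2 * \<tau>5 (w x)))" for x

  have "\<forall>\<^sub>F x in at_top. (let Q = Q_tilde (of_int B) (of_int p') (complex_of_real x);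
            R = {complex_of_real (t1 x), complex_of_real (t2 x), complex_of_real (t3 x),
                 t4 x, t5 x}
        in {t. poly Q t = 0 \<and> root_condition t} = R \<and> card R = 5 \<and>
           (\<forall>t\<in>R. order t Q = 1) \<and> t4 x \<notin> \<real> \<and> t5 x \<notin> \<real>)"
    using p_pos eventually_compose_filterlim[OF ev w_lim]
  proof eventually_elim
    case (elim x)
    define R where "R = {complex_of_real (t1 x), complex_of_real (t2 x), complex_of_real (t3 x), t4 x, t5 x}"
    have Q: "Q_tilde (of_int B) (of_int p') (complex_of_real x) = Q_poly (of_real (p x)) (of_real (w x) * of_real (p x))"
    proof -
      have "complex_of_real (w x) * of_real (p x) = of_real x"
        using elim by (simp add: w_def)
      then show ?thesis
        by (simp add: Q_tilde_def p_def b_def c_def)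
    qed
    have ord: "0 < t3 x" "t3 x < t2 x" "t2 x < t1 x"
      using elim by (simp_all add: t123)
    have im: "Re (t4 x) = 0" "Re (t5 x) = 0" "0 < Im (t5 x)" "Im (t5 x) < Im (t4 x)"
      using elim by (simp_all add: t45)
    have nonreal: "t4 x \<notin> \<real>" "t5 x \<notin> \<real>"
      using im by (auto simp: complex_is_Real_iff)
    then have "complex_of_real a \<noteq> t4 x" "complex_of_real a \<noteq> t5 x" for a
      by (metis Reals_of_real)+
    moreover have "t4 x \<noteq> t5 x"
      using im by force
    ultimately have "card R = 5"
      using ord unfolding R_def by simp
    moreover have "root_condition t" if "t \<in> R" for t
      using that ord im nonreal by (auto simp: R_def root_condition_def)
    moreover have "poly (Q_poly (of_real (p x)) (of_real (w x) * of_real (p x))) t = 0" if "t \<in> R" for t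
    proof -
      have re: "poly (Q_poly (of_real (p x)) (of_real (w x) * of_real (p x))) (complex_of_real (p x ^ 2 * s)) = 0"
        if "Q_red (w x) (s^2) = 0" for s
        using poly_Q_poly_scaled[of "complex_of_real (p x)" "of_real (w x)" "of_real s"] that
          Q_red_of_real[of "w x" "s^2"] by simp
      \<comment> \<open>The square of \<open>\<i> * s\<close> is \<open>- (s^2)\<close>, so negative
        zeros of the quintic yield purely imaginary roots.\<close>
      have im: "poly (Q_poly (of_real (p x)) (of_real (w x) * of_real (p x))) (\<i> * complex_of_real (p x ^ 2 * s)) = 0"
        if "Q_red (w x) (- (s^2)) = 0" for s
        using poly_Q_poly_scaled[of "complex_of_real (p x)" "of_real (w x)" "\<i> * of_real s"] that
          Q_red_of_real[of "w x" "- (s^2)"] by (simp add: power_mult_distrib mult_ac)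
      from \<open>t \<in> R\<close> show ?thesis
        unfolding R_def t123 t45 using elim by (auto intro!: re im simp del: of_real_mult of_real_power)
    qed
    ultimately show ?case
      unfolding Let_def Q R_def[symmetric] using nonreal Q_poly_roots_from_half[of R] by blast
  qed
  then obtain q_min where q_min: "\<forall>x > q_min. (let Q = Q_tilde (of_int B) (of_int p') (complex_of_real x);
            R = {complex_of_real (t1 x), complex_of_real (t2 x), complex_of_real (t3 x),
                 t4 x, t5 x}
        in {t. poly Q t = 0 \<and> root_condition t} = R \<and> card R = 5 \<and>
           (\<forall>t\<in>R. order t Q = 1) \<and> t4 x \<notin> \<real> \<and> t5 x \<notin> \<real>)"
    unfolding eventually_at_top_dense by blast
  have square_equiv: "(\<lambda>x. p x ^ 2 * \<tau> (w x)) \<sim>[at_top] (\<lambda>x. (of_int B)\<^sup>2 * x ^ 6)"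
    if "(\<tau> \<longlongrightarrow> 1) (at_right 0)" for \<tau> :: "real \<Rightarrow> real"
  proof (rule asymp_equivI')
    have "((\<lambda>x. (p x / (b * x^3))^2 * \<tau> (w x)) \<longlongrightarrow> 1) at_top"
      by (rule tendsto_eq_intros p_equiv filterlim_compose[OF that w_lim] refl | simp)+
    then show "((\<lambda>x. p x ^ 2 * \<tau> (w x) / ((of_int B)\<^sup>2 * x ^ 6)) \<longlongrightarrow> 1) at_top"
      by (simp add: power_divide power_mult_distrib b_def)
  qed
  have t12: "t1 \<sim>[at_top] (\<lambda>x. (of_int B)\<^sup>2 * x ^ 6)" "t2 \<sim>[at_top] (\<lambda>x. (of_int B)\<^sup>2 * x ^ 6)"
    unfolding t123 using square_equiv lim(1,2) by blast+
  have t3: "t3 \<sim>[at_top] (\<lambda>x. of_int B * x ^ 4)"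
  proof (rule asymp_equivI')
    have "((\<lambda>x. p x / (b * x^3) * \<tau>3 (w x)) \<longlongrightarrow> 1) at_top"
      by (rule tendsto_eq_intros p_equiv filterlim_compose[OF lim(3) w_lim] refl | simp)+
    then show "((\<lambda>x. t3 x / (of_int B * x ^ 4)) \<longlongrightarrow> 1) at_top"
      by (rule Lim_transform_eventually)
        (use p_pos x_pos in eventually_elim, use b in \<open>simp add: t123 w_def b_def field_simps power2_eq_square eval_nat_numeral\<close>)
  qed
  have im_equiv: "(\<lambda>x. \<i> * of_real (p x ^ 2 * (w x ^ 2 * \<tau> (w x)))) \<sim>[at_top] (\<lambda>x. of_real a * \<i> * of_real x ^ 2)"
    if "(\<tau> \<longlongrightarrow> a) (at_right 0)" "a \<noteq> 0" for \<tau> :: "real \<Rightarrow> real" and a :: real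
  proof (rule asymp_equivI')
    \<comment> \<open>\<open>p x ^ 2 * w x ^ 2 = x^2\<close> for large \<open>x\<close>, so the
      quotient reduces exactly to \<open>\<tau> (w x) / a\<close>.\<close>
    have "((\<lambda>x. complex_of_real (\<tau> (w x) / a)) \<longlongrightarrow> of_real 1) at_top"
      by (rule tendsto_eq_intros filterlim_compose[OF that(1) w_lim] refl | use that(2) in simp)+
    then show "((\<lambda>x. \<i> * complex_of_real (p x ^ 2 * (w x ^ 2 * \<tau> (w x))) / (of_real a * \<i> * of_real x ^ 2)) \<longlongrightarrow> 1) at_top"
      unfolding of_real_1
      by (rule Lim_transform_eventually)
        (use p_pos x_pos in eventually_elim, use that(2) in \<open>simp add: w_def field_simps\<close>)
  qed
  have "sqrt 2 + 1 \<noteq> (0::real)"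
    using real_sqrt_ge_zero[of 2] by linarith
  then have t4: "t4 \<sim>[at_top] (\<lambda>x. of_real (sqrt 2 + 1) * \<i> * of_real x ^ 2)"
    unfolding t45 by (rule im_equiv[OF lim(4)])
  have t5: "t5 \<sim>[at_top] (\<lambda>x. of_real (sqrt 2 - 1) * \<i> * of_real x ^ 2)"
    unfolding t45 by (rule im_equiv[OF lim(5)]) simp
  show ?thesis
    using q_min t12 t3 t4 t5
    by (intro exI[of _ q_min] exI[of _ t1] exI[of _ t2] exI[of _ t3] exI[of _ t4] exI[of _ t5] conjI)
qed

end
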